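(* Let $K$ be a skew field (with the discrete topology), let $\mathfrak{G}$ be a balanced filter on a set $G$ with involution $*$, and let $\mathcal{M}(\mathfrak{G})$ be the set of all $G\times G$-matrices $\Phi$ over $K$ such that $\mathcal{Z}(\Phi)\in\langle\mathfrak{G},\mathfrak{G}^{\perp *}\rangle$. Then: a) $\mathcal{M}(\mathfrak{G})$ is a ring with respect to (entrywise) addition and multiplication of matrices, where the product is given by $(\Phi\cdot\Psi)_j^g=\sum_{h\in G}\Phi_j^{h^*}\Psi_h^g$. b) If $\Phi\in\mathcal{M}(\mathfrak{G})$, then the map $\widehat{\Phi}:\mathbf{a}\mapsto\Phi\cdot\mathbf{a}$ is a continuous endomorphism of the column space $\{\mathfrak{G}\}K$ (with topology $T(\mathfrak{G})$). c) The map $\Phi\mapsto\widehat{\Phi}$ is an isomorphism from $\mathcal{M}(\mathfrak{G})$ onto the ring of all continuous endomorphisms of the space $\{\mathfrak{G}\}K$.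
   Context: Filters. A filter on a set $S$ is a nonempty collection of subsets of $S$ closed under finite intersections and supersets ($\mathcal{P}(S)$ is allowed). $\overline{A}$ denotes the complement of $A$ in the ambient set. For a filter $\mathfrak{F}$ on $S$, $\mathfrak{F}^{\perp}=\{A\subseteq S\mid A\cup A' \text{ is cofinite in } S \text{ for every } A'\in\mathfrak{F}\}$; this is a filter. $\mathfrak{F}$ is balanced if $\mathfrak{F}^{\perp\perp}=\mathfrak{F}$. An involution on $S$ is a map $*:S\to S$ with $s^{**}=s$; $A^*=\{a^*\mid a\in A\}$, $\mathfrak{F}^*=\{A^*\mid A\in\mathfrak{F}\}$, and $\mathfrak{F}^{\perp *}=(\mathfrak{F}^{\perp})^*$. For filters $\mathfrak{H}$ on $H$ and $\mathfrak{F}$ on $G$, $\langle\mathfrak{H},\mathfrak{F}\rangle$ is the filter on $H\times G$ of all $X\subseteq H\times G$ such that: for every $A\in\mathfrak{F}^{\perp}$ there is $B'\in\mathfrak{H}$ with $B'\times\overline{A}\subseteq X$; and for every $B\in\mathfrak{H}^{\perp}$ there is $A'\in\mathfrak{F}$ with $\overline{B}\times A'\subseteq X$. Spaces. For $f:S\to K$, $\mathcal{Z}(f)=\{s\mid f(s)=0\}$, $\mathrm{supp}(f)=\{s\mid f(s)\neq0\}$. $\{\mathfrak{G}\}K$ is the right $K$-vector space (of columns) $\{f:G\to K\mid\mathcal{Z}(f)\in\mathfrak{G}\}$. The topology $T(\mathfrak{G})$ on it is the linear topology having as a base of neighbourhoods of zero the subspaces $U(A,\mathfrak{G})=\{f\in\{\mathfrak{G}\}K\mid\mathrm{supp}(f)\subseteq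 A\}$, $A\in\mathfrak{G}^{\perp}$. A continuous endomorphism of $\{\mathfrak{G}\}K$ is a continuous (right) $K$-linear map from the space to itself; these form a ring under pointwise addition and composition. Matrices. A $G\times G$-matrix is a map $\Phi:G\times G\to K$ with $(h,g)$-entry $\Phi_h^g$; $\mathcal{Z}(\Phi)=\{(h,g)\mid\Phi_h^g=0\}$. The product $\Phi\cdot\Psi$ is defined if for every pair $(j,g)$ only finitely many summands in $\sum_{h}\Phi_j^{h^*}\Psi_h^g$ are nonzero. For a column $\mathbf{a}=(a_g)_{g\in G}$, $(\Phi\cdot\mathbf{a})_h=\sum_{g\in G}\Phi_h^{g^*}a_g$ (defined if for every $h$ only finitely many summands are nonzero). Part a) includes the assertion that products of elements of $\mathcal{M}(\mathfrak{G})$ are defined. *)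

theory Defs
  imports "HOL-Analysis.Abstract_Topology" "HOL-Algebra.QuotRing"
begin

section \<open>Filters on a set\<close>

text \<open>The library type of filters lives on a whole type; here filters are set systems on a
  carrier set \<open>S\<close>, which may be empty.  The improper filter \<open>Pow S\<close> is allowed.\<close>

definition is_filter_on :: "'a set \<Rightarrow> 'a set set \<Rightarrow> bool" where
  "is_filter_on S F \<longleftrightarrow> F \<noteq> {} \<and> F \<subseteq> Pow S \<and>
     (\<forall>A\<in>F. \<forall>B\<in>F. A \<inter> B \<in> F) \<and>
     (\<forall>A\<in>F. \<forall>B. A \<subseteq> B \<and> B \<subseteq> S \<longrightarrow> B \<in> F)"

definition perp :: "'a set \<Rightarrow> 'a set set \<Rightarrow> 'a set set" where
  "perp S F = {A. A \<subseteq> S \<and> (\<forall>A'\<in>F. finite (S - (A \<union> A')))}"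

definition balanced :: "'a set \<Rightarrow> 'a set set \<Rightarrow> bool" where
  "balanced S F \<longleftrightarrow> perp S (perp S F) = F"

definition involution_on :: "'a set \<Rightarrow> ('a \<Rightarrow> 'a) \<Rightarrow> bool" where
  "involution_on S star \<longleftrightarrow> (\<forall>s\<in>S. star s \<in> S \<and> star (star s) = s)"

definition star_filter :: "('a \<Rightarrow> 'a) \<Rightarrow> 'a set set \<Rightarrow> 'a set set" where
  "star_filter star F = (\<lambda>A. star ` A) ` F"

definition angle_filter ::
  "'h set \<Rightarrow> 'h set set \<Rightarrow> 'g set \<Rightarrow> 'g set set \<Rightarrow> ('h \<times> 'g) set set" where
  "angle_filter H FH G FG = {X. X \<subseteq> H \<times> G \<and>
     (\<forall>A\<in>perp G FG. \<exists>B'\<in>FH. B' \<times> (G - A) \<subseteq> X) \<and>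
     (\<forall>B\<in>perp H FH. \<exists>A'\<in>FG. (H - B) \<times> A' \<subseteq> X)}"

lemma is_filter_on_perp: "is_filter_on S (perp S F)"
  unfolding is_filter_on_def
proof (intro conjI ballI allI impI)
  have "finite (S - (S \<union> A))" for A
  proof -
    have "S - (S \<union> A) = {}" by blast
    then show ?thesis by (simp only: finite.emptyI)
  qed
  then have "S \<in> perp S F" unfolding perp_def by blast
  then show "perp S F \<noteq> {}" by blast
  show "perp S F \<subseteq> Pow S" by (auto simp: perp_def)
next
  fix A B assume A: "A \<in> perp S F" and B: "B \<in> perp S F"
  have "finite (S - (A \<inter> B \<union> C))" if "C \<in> F" for C
  proof -
    have "S - (A \<inter> B \<union> C) \<subseteq> (S - (A \<union> C)) \<union> (S - (B \<union> C))" by blast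
    moreover have "finite (S - (A \<union> C))" "finite (S - (B \<union> C))"
      using A B that unfolding perp_def by blast+
    ultimately show ?thesis by (meson finite_subset finite_UnI)
  qed
  then show "A \<inter> B \<in> perp S F" using A unfolding perp_def by blast
next
  fix A B assume A: "A \<in> perp S F" and B: "A \<subseteq> B \<and> B \<subseteq> S"
  have "finite (S - (B \<union> C))" if "C \<in> F" for C
  proof -
    have "S - (B \<union> C) \<subseteq> S - (A \<union> C)" using B by blast
    moreover have "finite (S - (A \<union> C))"
      using A that unfolding perp_def by blast
    ultimately show ?thesis by (meson finite_subset)
  qed
  then show "B \<in> perp S F" using B unfolding perp_def by blast
qed


section \<open>Column spaces and their topology\<close>

text \<open>Maps \<open>S \<rightarrow> K\<close> are represented by extensional functions, so that equality of maps on
  \<open>S\<close> is equality in HOL.\<close>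

definition zero_set :: "'a set \<Rightarrow> ('a \<Rightarrow> 'k::zero) \<Rightarrow> 'a set" where
  "zero_set S f = {s \<in> S. f s = 0}"

definition supp_set :: "'a set \<Rightarrow> ('a \<Rightarrow> 'k::zero) \<Rightarrow> 'a set" where
  "supp_set S f = {s \<in> S. f s \<noteq> 0}"

definition fun_zero_on :: "'a set \<Rightarrow> 'a \<Rightarrow> 'k::zero" where
  "fun_zero_on S = (\<lambda>s\<in>S. 0)"

definition fun_add_on :: "'a set \<Rightarrow> ('a \<Rightarrow> 'k::plus) \<Rightarrow> ('a \<Rightarrow> 'k) \<Rightarrow> 'a \<Rightarrow> 'k" where
  "fun_add_on S f g = (\<lambda>s\<in>S. f s + g s)"

definition fun_scale_right_on :: "'a set \<Rightarrow> ('a \<Rightarrow> 'k::times) \<Rightarrow> 'k \<Rightarrow> 'a \<Rightarrow> 'k" where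
  "fun_scale_right_on S f c = (\<lambda>s\<in>S. f s * c)"

definition column_space :: "'g set \<Rightarrow> 'g set set \<Rightarrow> ('g \<Rightarrow> 'k::zero) set" where
  "column_space G F = {f \<in> G \<rightarrow>\<^sub>E UNIV. zero_set G f \<in> F}"

definition column_nbhd :: "'g set \<Rightarrow> 'g set set \<Rightarrow> 'g set \<Rightarrow> ('g \<Rightarrow> 'k::zero) set" where
  "column_nbhd G F A = {f \<in> column_space G F. supp_set G f \<subseteq> A}"

text \<open>The translation-invariant topology in which the subspaces \<open>column_nbhd G F A\<close> with
  \<open>A \<in> perp G F\<close> form a base of neighbourhoods of zero: a set is open iff with each of
  its points \<open>f\<close> it contains a coset \<open>f + column_nbhd G F A\<close>.\<close>

definition column_topology :: "'g set \<Rightarrow> 'g set set \<Rightarrow> ('g \<Rightarrow> 'k::monoid_add) topology" where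
  "column_topology G F = topology (\<lambda>W. W \<subseteq> column_space G F \<and>
     (\<forall>f\<in>W. \<exists>A\<in>perp G F. fun_add_on G f ` column_nbhd G F A \<subseteq> W))"

lemma istopology_column:
  "istopology (\<lambda>W :: ('g \<Rightarrow> 'k::monoid_add) set. W \<subseteq> column_space G F \<and>
     (\<forall>f\<in>W. \<exists>A\<in>perp G F. fun_add_on G f ` column_nbhd G F A \<subseteq> W))"
  unfolding istopology_def
proof (intro conjI allI impI)
  fix V W :: "('g \<Rightarrow> 'k) set"
  assume V: "V \<subseteq> column_space G F \<and>
      (\<forall>f\<in>V. \<exists>A\<in>perp G F. fun_add_on G f ` column_nbhd G F A \<subseteq> V)"
    and W: "W \<subseteq> column_space G F \<and>
      (\<forall>f\<in>W. \<exists>A\<in>perp G F. fun_add_on G f ` column_nbhd G F A \<subseteq> W)"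
  show "V \<inter> W \<subseteq> column_space G F" using V by blast
  show "\<forall>f\<in>V \<inter> W. \<exists>A\<in>perp G F. fun_add_on G f ` column_nbhd G F A \<subseteq> V \<inter> W"
  proof
    fix f assume f: "f \<in> V \<inter> W"
    obtain A where A: "A \<in> perp G F" "fun_add_on G f ` column_nbhd G F A \<subseteq> V"
      using V f by blast
    obtain B where B: "B \<in> perp G F" "fun_add_on G f ` column_nbhd G F B \<subseteq> W"
      using W f by blast
    have "A \<inter> B \<in> perp G F"
      using is_filter_on_perp[of G F] A B by (auto simp: is_filter_on_def)
    moreover have "fun_add_on G f ` column_nbhd G F (A \<inter> B) \<subseteq> V \<inter> W"
      using A B by (auto simp: column_nbhd_def)
    ultimately show "\<exists>A\<in>perp G F. fun_add_on G f ` column_nbhd G F A \<subseteq> V \<inter> W" by blast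
  qed
next
  fix \<W> :: "('g \<Rightarrow> 'k) set set"
  assume \<W>: "\<forall>W\<in>\<W>. W \<subseteq> column_space G F \<and>
      (\<forall>f\<in>W. \<exists>A\<in>perp G F. fun_add_on G f ` column_nbhd G F A \<subseteq> W)"
  show "\<Union>\<W> \<subseteq> column_space G F" using \<W> by blast
  show "\<forall>f\<in>\<Union>\<W>. \<exists>A\<in>perp G F. fun_add_on G f ` column_nbhd G F A \<subseteq> \<Union>\<W>"
    using \<W> by (meson Union_iff subset_iff)
qed

lemma openin_column_topology:
  "openin (column_topology G F) W \<longleftrightarrow> W \<subseteq> column_space G F \<and>
     (\<forall>f\<in>W. \<exists>A\<in>perp G F. fun_add_on G f ` column_nbhd G F A \<subseteq> W)"
  unfolding column_topology_def topology_inverse'[OF istopology_column] by (rule refl)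

lemma fun_add_on_in_column_space:
  fixes f u :: "'g \<Rightarrow> 'k::monoid_add"
  assumes "is_filter_on G F" "f \<in> column_space G F" "u \<in> column_space G F"
  shows "fun_add_on G f u \<in> column_space G F"
proof -
  have "zero_set G f \<inter> zero_set G u \<in> F"
    using assms by (auto simp: is_filter_on_def column_space_def)
  moreover have "zero_set G f \<inter> zero_set G u \<subseteq> zero_set G (fun_add_on G f u)"
    by (auto simp: zero_set_def fun_add_on_def)
  moreover have "zero_set G (fun_add_on G f u) \<subseteq> G" by (auto simp: zero_set_def)
  ultimately have "zero_set G (fun_add_on G f u) \<in> F"
    using assms(1) by (auto simp: is_filter_on_def)
  then show ?thesis by (simp add: column_space_def fun_add_on_def)
qed

lemma openin_column_nbhd:
  assumes "is_filter_on G F" "A \<in> perp G F"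
  shows "openin (column_topology G F) (column_nbhd G F A :: ('g \<Rightarrow> 'k::monoid_add) set)"
proof -
  have "fun_add_on G f u \<in> column_nbhd G F A"
    if "f \<in> column_nbhd G F A" "u \<in> column_nbhd G F A" for f u :: "'g \<Rightarrow> 'k"
    using that fun_add_on_in_column_space[OF assms(1), of f u]
    by (force simp: column_nbhd_def supp_set_def fun_add_on_def)
  then have "fun_add_on G f ` column_nbhd G F A \<subseteq> column_nbhd G F A"
    if "f \<in> column_nbhd G F A" for f :: "'g \<Rightarrow> 'k"
    using that by (intro image_subsetI)
  moreover have "column_nbhd G F A \<subseteq> (column_space G F :: ('g \<Rightarrow> 'k) set)"
    by (auto simp: column_nbhd_def)
  ultimately show ?thesis
    unfolding openin_column_topology by (intro conjI ballI bexI[OF _ assms(2)])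
qed

lemma topspace_column_topology:
  assumes "is_filter_on G F"
  shows "topspace (column_topology G F) = (column_space G F :: ('g \<Rightarrow> 'k::monoid_add) set)"
proof
  show "topspace (column_topology G F) \<subseteq> (column_space G F :: ('g \<Rightarrow> 'k) set)"
    using openin_topspace[of "column_topology G F"] unfolding openin_column_topology by blast
  have "G \<in> perp G F"
    using is_filter_on_perp[of G F] unfolding is_filter_on_def by blast
  moreover have "column_nbhd G F G = (column_space G F :: ('g \<Rightarrow> 'k) set)"
    by (auto simp: column_nbhd_def supp_set_def)
  ultimately have "openin (column_topology G F) (column_space G F :: ('g \<Rightarrow> 'k) set)"
    using openin_column_nbhd[OF assms] by metis
  then show "(column_space G F :: ('g \<Rightarrow> 'k) set) \<subseteq> topspace (column_topology G F)"
    by (rule openin_subset)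
qed

definition continuous_endomorphisms ::
  "'g set \<Rightarrow> 'g set set \<Rightarrow> (('g \<Rightarrow> 'k::division_ring) \<Rightarrow> 'g \<Rightarrow> 'k) set" where
  "continuous_endomorphisms G F =
     {\<phi> \<in> column_space G F \<rightarrow>\<^sub>E column_space G F.
        (\<forall>a\<in>column_space G F. \<forall>b\<in>column_space G F.
           \<phi> (fun_add_on G a b) = fun_add_on G (\<phi> a) (\<phi> b)) \<and>
        (\<forall>a\<in>column_space G F. \<forall>c.
           \<phi> (fun_scale_right_on G a c) = fun_scale_right_on G (\<phi> a) c) \<and>
        continuous_map (column_topology G F) (column_topology G F) \<phi>}"

definition endomorphism_ring ::
  "'g set \<Rightarrow> 'g set set \<Rightarrow> (('g \<Rightarrow> 'k::division_ring) \<Rightarrow> 'g \<Rightarrow> 'k) ring" where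
  "endomorphism_ring G F =
     \<lparr>carrier = continuous_endomorphisms G F,
      mult = (\<lambda>\<phi> \<psi>. compose (column_space G F) \<phi> \<psi>),
      one = (\<lambda>a\<in>column_space G F. a),
      zero = (\<lambda>a\<in>column_space G F. fun_zero_on G),
      add = (\<lambda>\<phi> \<psi>. \<lambda>a\<in>column_space G F. fun_add_on G (\<phi> a) (\<psi> a))\<rparr>"


section \<open>Matrices\<close>

text \<open>The entry of \<open>\<Phi>\<close> with lower index \<open>h\<close> and upper index \<open>g\<close> is \<open>\<Phi> (h, g)\<close>.  In products the
  summation index is starred in the upper position.  The library's \<open>sum'\<close> adds up the nonzero
  summands, and is 0 by convention if there are infinitely many of them; the predicates
  \<open>matrix_mult_defined\<close> and \<open>matrix_vec_defined\<close> exclude that case.\<close>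

definition matrix_mult_defined ::
  "'g set \<Rightarrow> ('g \<Rightarrow> 'g) \<Rightarrow> ('g \<times> 'g \<Rightarrow> 'k::division_ring) \<Rightarrow> ('g \<times> 'g \<Rightarrow> 'k) \<Rightarrow> bool" where
  "matrix_mult_defined G star \<Phi> \<Psi> \<longleftrightarrow>
     (\<forall>j\<in>G. \<forall>g\<in>G. finite {h \<in> G. \<Phi> (j, star h) * \<Psi> (h, g) \<noteq> 0})"

definition matrix_mult ::
  "'g set \<Rightarrow> ('g \<Rightarrow> 'g) \<Rightarrow> ('g \<times> 'g \<Rightarrow> 'k::division_ring) \<Rightarrow> ('g \<times> 'g \<Rightarrow> 'k) \<Rightarrow> 'g \<times> 'g \<Rightarrow> 'k" where
  "matrix_mult G star \<Phi> \<Psi> = (\<lambda>(j, g)\<in>G \<times> G. sum' (\<lambda>h. \<Phi> (j, star h) * \<Psi> (h, g)) G)"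

definition matrix_vec_defined ::
  "'g set \<Rightarrow> ('g \<Rightarrow> 'g) \<Rightarrow> ('g \<times> 'g \<Rightarrow> 'k::division_ring) \<Rightarrow> ('g \<Rightarrow> 'k) \<Rightarrow> bool" where
  "matrix_vec_defined G star \<Phi> a \<longleftrightarrow> (\<forall>h\<in>G. finite {g \<in> G. \<Phi> (h, star g) * a g \<noteq> 0})"

definition matrix_vec ::
  "'g set \<Rightarrow> ('g \<Rightarrow> 'g) \<Rightarrow> ('g \<times> 'g \<Rightarrow> 'k::division_ring) \<Rightarrow> ('g \<Rightarrow> 'k) \<Rightarrow> 'g \<Rightarrow> 'k" where
  "matrix_vec G star \<Phi> a = (\<lambda>h\<in>G. sum' (\<lambda>g. \<Phi> (h, star g) * a g) G)"

definition filter_matrices ::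
  "'g set \<Rightarrow> ('g \<Rightarrow> 'g) \<Rightarrow> 'g set set \<Rightarrow> ('g \<times> 'g \<Rightarrow> 'k::division_ring) set" where
  "filter_matrices G star F =
     {\<Phi> \<in> G \<times> G \<rightarrow>\<^sub>E UNIV.
        zero_set (G \<times> G) \<Phi> \<in> angle_filter G F G (star_filter star (perp G F))}"

text \<open>The unit matrix for the starred product has its ones at the positions \<open>(g, star g)\<close>.\<close>

definition matrix_ring ::
  "'g set \<Rightarrow> ('g \<Rightarrow> 'g) \<Rightarrow> 'g set set \<Rightarrow> ('g \<times> 'g \<Rightarrow> 'k::division_ring) ring" where
  "matrix_ring G star F =
     \<lparr>carrier = filter_matrices G star F,
      mult = matrix_mult G star,
      one = (\<lambda>(h, g)\<in>G \<times> G. if h = star g then 1 else 0),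
      zero = fun_zero_on (G \<times> G),
      add = fun_add_on (G \<times> G)\<rparr>"

definition hat ::
  "'g set \<Rightarrow> ('g \<Rightarrow> 'g) \<Rightarrow> 'g set set \<Rightarrow> ('g \<times> 'g \<Rightarrow> 'k::division_ring) \<Rightarrow>
   ('g \<Rightarrow> 'k) \<Rightarrow> 'g \<Rightarrow> 'k" where
  "hat G star F \<Phi> = (\<lambda>a\<in>column_space G F. matrix_vec G star \<Phi> a)"

end

theory Submission
  imports Defs
begin

text \<open>
  Write \<open>P = perp G F\<close>, and \<open>e\<^sub>g\<close> for the column with a 1 in position \<open>g\<close> and zeros elsewhere.
  After undoing the star in the upper index, a matrix \<open>\<Phi>\<close> belongs to the matrix ring iff

    \<^item> for every \<open>A \<in> F\<close> there is \<open>B \<in> F\<close> such that the rows in \<open>B\<close> vanish outside \<open>A\<close>, and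
    \<^item> for every \<open>B \<in> P\<close> there is \<open>A \<in> P\<close> such that the rows outside \<open>B\<close> vanish on \<open>A\<close>

  (\<open>filter_matrices_iff\<close>; balancedness enters through \<open>perp G P = F\<close>).  The second condition says
  that the columns supported in \<open>A\<close> are sent to columns supported in \<open>B\<close>, which is
  continuity at zero.  Taking for \<open>B\<close> the complement of a point, it says that every row vanishes on
  a set in \<open>P\<close>; as a column vanishes on a set in \<open>F\<close>, and the union of the two sets is cofinite,
  every sum in \<open>\<Phi> \<cdot> a\<close> is finite.  The first condition says that \<open>\<Phi> \<cdot> a\<close> is again in the
  column space.  This gives the map from matrices to endomorphisms (\<open>hat_endomorphism\<close>), and
  products of matrices are defined because the columns of a matrix are elements of the column space.

  Conversely, let \<open>T\<close> be a continuous endomorphism.  In a fixed position \<open>h\<close>, continuity gives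
  \<open>C \<in> P\<close> such that \<open>T\<close> kills position \<open>h\<close> of every column supported in \<open>C\<close>.  The part of a column
  \<open>a\<close> outside \<open>C\<close> has finite support, so \<open>(T a)\<^sub>h = \<Sum>\<^sub>g (T e\<^sub>g)\<^sub>h a\<^sub>g\<close> is a finite sum
  (\<open>endomorphism_expansion\<close>), and \<open>T\<close> is given by the matrix of the columns \<open>T e\<^sub>g\<close>.  This matrix
  satisfies the second condition by continuity.  The first then comes for free, by
  balancedness: it suffices to see that a set meets the test for \<open>perp G P\<close>, and against each
  member of \<open>P\<close> only finitely many columns matter, each vanishing on a set in \<open>F\<close>
  (\<open>endo_matrix_closed\<close>).

  So matrices and endomorphisms correspond bijectively, and by the expansion formula the
  composition of endomorphisms becomes the product of matrices.  That the continuous endomorphisms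
  form a ring is checked pointwise; the ring axioms for matrices, including closure under the product
  and associativity, are transported along the bijection, with no manipulation of double sums.
\<close>

section \<open>Filters and involutions\<close>

lemma perpD: "A \<in> perp S F \<Longrightarrow> A' \<in> F \<Longrightarrow> finite (S - (A \<union> A'))"
  by (auto simp: perp_def)

lemma cofinite_in_perp:
  assumes "A \<subseteq> S" "finite (S - A)"
  shows "A \<in> perp S F"
proof -
  have "finite (S - (A \<union> A'))" for A'
    using assms(2) by (rule finite_subset[rotated]) blast
  then show ?thesis using assms(1) by (simp add: perp_def)
qed

lemma remove_point_in_perp: "S - {s} \<in> perp S F"
  by (rule cofinite_in_perp) (auto intro: finite_subset[of _ "{s}"])

lemma star_image_perp:
  assumes inv: "involution_on S star" and F: "F \<subseteq> Pow S" and A: "A \<in> perp S F"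
  shows "star ` A \<in> perp S (star_filter star F)"
  unfolding perp_def
proof (intro CollectI conjI ballI)
  have AS: "A \<subseteq> S" using A by (simp add: perp_def)
  then show "star ` A \<subseteq> S" using inv by (auto simp: involution_on_def)
  fix C assume "C \<in> star_filter star F"
  then obtain A' where A': "A' \<in> F" and C: "C = star ` A'" by (auto simp: star_filter_def)
  have "S - (star ` A \<union> C) \<subseteq> star ` (S - (A \<union> A'))"
  proof
    fix s assume s: "s \<in> S - (star ` A \<union> C)"
    then have "star s \<in> S" "s = star (star s)" using inv by (auto simp: involution_on_def)
    moreover from this have "star s \<notin> A \<union> A'" using s C by (metis DiffD2 UnCI UnE imageI)
    ultimately show "s \<in> star ` (S - (A \<union> A'))" by blast
  qed
  then show "finite (S - (star ` A \<union> C))"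
    using perpD[OF A A'] by (meson finite_imageI finite_subset)
qed

lemma star_image_involution:
  assumes "involution_on S star" "A \<subseteq> S"
  shows "star ` star ` A = A"
proof -
  have "(\<lambda>x. star (star x)) ` A = (\<lambda>x. x) ` A"
    using assms by (intro image_cong) (auto simp: involution_on_def)
  then show ?thesis by (simp add: image_image)
qed

lemma star_filter_involution:
  assumes "involution_on S star" "F \<subseteq> Pow S"
  shows "star_filter star (star_filter star F) = F"
proof -
  have "(\<lambda>A. star ` star ` A) ` F = (\<lambda>A. A) ` F"
    using assms by (intro image_cong star_image_involution) auto
  then show ?thesis by (simp add: star_filter_def image_image)
qed

text \<open>The definition of the matrix ring involves \<open>perp\<close> of the starred filter of \<open>perp S F\<close>.  For
  balanced \<open>F\<close> this is the starred filter of \<open>F\<close>, by the next lemma with \<open>perp S F\<close> in place of \<open>F\<close>.\<close>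

lemma perp_star_filter:
  assumes inv: "involution_on S star" and F: "F \<subseteq> Pow S"
  shows "perp S (star_filter star F) = star_filter star (perp S F)"
proof
  show "star_filter star (perp S F) \<subseteq> perp S (star_filter star F)"
    using star_image_perp[OF inv F] by (auto simp: star_filter_def)
  show "perp S (star_filter star F) \<subseteq> star_filter star (perp S F)"
  proof
    fix A assume A: "A \<in> perp S (star_filter star F)"
    have "star_filter star F \<subseteq> Pow S"
      using inv F by (auto simp: star_filter_def involution_on_def)
    from star_image_perp[OF inv this A] have "star ` A \<in> perp S F"
      by (simp add: star_filter_involution[OF inv F])
    moreover have "star ` star ` A = A"
      using A by (intro star_image_involution[OF inv]) (simp add: perp_def)
    ultimately show "A \<in> star_filter star (perp S F)" unfolding star_filter_def by blast
  qed
qed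

section \<open>The column space of a balanced filter\<close>

definition unit_column :: "'g set \<Rightarrow> 'g \<Rightarrow> 'g \<Rightarrow> 'k::division_ring" where
  "unit_column G g = (\<lambda>s\<in>G. if s = g then 1 else 0)"

locale balanced_filter =
  fixes G :: "'g set" and F :: "'g set set"
  assumes filter_F: "is_filter_on G F" and balanced_F: "balanced G F"
begin

lemma perp_perp: "perp G (perp G F) = F"
  using balanced_F by (simp add: balanced_def)

lemma cofinite_in_filter: "A \<subseteq> G \<Longrightarrow> finite (G - A) \<Longrightarrow> A \<in> F"
  using cofinite_in_perp[of A G "perp G F"] by (simp add: perp_perp)

lemma remove_point_in_filter: "G - {g} \<in> F"
  using remove_point_in_perp[of G g "perp G F"] by (simp add: perp_perp)

text \<open>Being balanced means that membership in \<open>F\<close> can be tested against \<open>perp G F\<close>.  This is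
  how the hypothesis enters the proof that the matrix of an endomorphism lies in the matrix ring.\<close>

lemma filterI: "A \<subseteq> G \<Longrightarrow> (\<And>B. B \<in> perp G F \<Longrightarrow> finite (G - (A \<union> B))) \<Longrightarrow> A \<in> F"
  by (subst perp_perp[symmetric]) (simp add: perp_def)

lemma filter_subset: "A \<in> F \<Longrightarrow> A \<subseteq> G"
  using filter_F by (auto simp: is_filter_on_def)

lemma filter_superset: "A \<in> F \<Longrightarrow> A \<subseteq> B \<Longrightarrow> B \<subseteq> G \<Longrightarrow> B \<in> F"
  using filter_F by (auto simp: is_filter_on_def)

lemma perp_subset: "A \<in> perp G F \<Longrightarrow> A \<subseteq> G"
  by (simp add: perp_def)

lemma column_spaceI:
  assumes "a \<in> extensional G" "A \<in> F" "\<And>g. g \<in> A \<Longrightarrow> a g = 0"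
  shows "a \<in> column_space G F"
proof -
  have "zero_set G a \<in> F"
    using assms(2) by (rule filter_superset) (use assms filter_subset in \<open>auto simp: zero_set_def\<close>)
  then show ?thesis using assms(1) by (auto simp: column_space_def PiE_def)
qed

lemma column_space_cases:
  assumes "a \<in> column_space G F"
  obtains A where "A \<in> F" "\<And>g. g \<in> A \<Longrightarrow> a g = 0"
proof (rule that)
  show "zero_set G a \<in> F" using assms by (simp add: column_space_def)
qed (simp add: zero_set_def)

lemma column_space_extensional: "a \<in> column_space G F \<Longrightarrow> a \<in> extensional G"
  by (auto simp: column_space_def PiE_def)

lemma column_eqI:
  assumes "a \<in> column_space G F" "b \<in> column_space G F" "\<And>g. g \<in> G \<Longrightarrow> a g = b g"
  shows "a = b"
  using assms column_space_extensional by (metis extensionalityI)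

lemma column_zero: "(fun_zero_on G :: 'g \<Rightarrow> 'k::zero) \<in> column_space G F"
  by (rule column_spaceI[of _ G]) (auto simp: fun_zero_on_def cofinite_in_filter)

lemma column_add:
  fixes a :: "'g \<Rightarrow> 'k::monoid_add"
  shows "a \<in> column_space G F \<Longrightarrow> b \<in> column_space G F \<Longrightarrow> fun_add_on G a b \<in> column_space G F"
  by (rule fun_add_on_in_column_space[OF filter_F])

lemma column_scale:
  fixes a :: "'g \<Rightarrow> 'k::division_ring"
  assumes "a \<in> column_space G F"
  shows "fun_scale_right_on G a c \<in> column_space G F"
proof -
  obtain A where "A \<in> F" "\<And>g. g \<in> A \<Longrightarrow> a g = 0" using column_space_cases[OF assms] by blast
  then show ?thesis
    by (intro column_spaceI[of _ A]) (use filter_subset in \<open>auto simp: fun_scale_right_on_def\<close>)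
qed

lemma column_unit: "(unit_column G g :: 'g \<Rightarrow> 'k::division_ring) \<in> column_space G F"
proof (rule column_spaceI)
  show "G - {g} \<in> F" by (rule remove_point_in_filter)
qed (auto simp: unit_column_def)

lemma nbhd_iff:
  "a \<in> column_nbhd G F A \<longleftrightarrow> a \<in> column_space G F \<and> (\<forall>g\<in>G - A. a g = 0)"
  by (auto simp: column_nbhd_def supp_set_def)

lemma unit_column_nbhd:
  "g \<in> A \<Longrightarrow> (unit_column G g :: 'g \<Rightarrow> 'k::division_ring) \<in> column_nbhd G F A"
  by (auto simp: nbhd_iff column_unit) (auto simp: unit_column_def)


section \<open>Continuous endomorphisms\<close>

lemma additive_zero:
  fixes T :: "('g \<Rightarrow> 'k::division_ring) \<Rightarrow> 'g \<Rightarrow> 'k"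
  assumes T: "T \<in> column_space G F \<rightarrow> column_space G F"
    and add: "\<And>a b. a \<in> column_space G F \<Longrightarrow> b \<in> column_space G F \<Longrightarrow>
      T (fun_add_on G a b) = fun_add_on G (T a) (T b)"
  shows "T (fun_zero_on G) = fun_zero_on G"
proof (rule column_eqI)
  show "T (fun_zero_on G) \<in> column_space G F" using T column_zero by blast
  show "(fun_zero_on G :: 'g \<Rightarrow> 'k) \<in> column_space G F" by (rule column_zero)
  fix g assume g: "g \<in> G"
  have "fun_add_on G (fun_zero_on G) (fun_zero_on G) = (fun_zero_on G :: 'g \<Rightarrow> 'k)"
    by (auto simp: fun_add_on_def fun_zero_on_def)
  then have "T (fun_zero_on G) g = fun_add_on G (T (fun_zero_on G)) (T (fun_zero_on G)) g"
    using add[OF column_zero column_zero] by simp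
  then show "T (fun_zero_on G) g = (fun_zero_on G :: 'g \<Rightarrow> 'k) g"
    using g by (simp add: fun_add_on_def fun_zero_on_def)
qed

text \<open>As the topology is translation invariant, an additive map is continuous as soon as it is
  continuous at zero.\<close>

lemma continuous_additive_iff:
  fixes T :: "('g \<Rightarrow> 'k::division_ring) \<Rightarrow> 'g \<Rightarrow> 'k"
  assumes T: "T \<in> column_space G F \<rightarrow> column_space G F"
    and add: "\<And>a b. a \<in> column_space G F \<Longrightarrow> b \<in> column_space G F \<Longrightarrow>
      T (fun_add_on G a b) = fun_add_on G (T a) (T b)"
  shows "continuous_map (column_topology G F) (column_topology G F) T \<longleftrightarrow>
    (\<forall>B\<in>perp G F. \<exists>A\<in>perp G F. T ` column_nbhd G F A \<subseteq> column_nbhd G F B)"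
    (is "_ \<longleftrightarrow> ?R")
proof
  assume cont: "continuous_map (column_topology G F) (column_topology G F) T"
  show ?R
  proof
    fix B assume B: "B \<in> perp G F"
    let ?W = "{a \<in> column_space G F. T a \<in> column_nbhd G F B}"
    have "openin (column_topology G F) ?W"
      using cont openin_column_nbhd[OF filter_F B]
      unfolding continuous_map_def topspace_column_topology[OF filter_F] by blast
    moreover have "fun_zero_on G \<in> ?W"
      by (auto simp: additive_zero[OF T add] column_zero nbhd_iff) (simp add: fun_zero_on_def)
    ultimately obtain A where A: "A \<in> perp G F"
      and sub: "fun_add_on G (fun_zero_on G) ` column_nbhd G F A \<subseteq> ?W"
      unfolding openin_column_topology by blast
    have "T a \<in> column_nbhd G F B" if "a \<in> column_nbhd G F A" for a
    proof -
      have "fun_add_on G (fun_zero_on G) a = a"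
        using that column_space_extensional[of a]
        by (intro extensionalityI[of _ G])
          (auto simp: fun_add_on_def fun_zero_on_def nbhd_iff)
      then show ?thesis using sub that by force
    qed
    then show "\<exists>A\<in>perp G F. T ` column_nbhd G F A \<subseteq> column_nbhd G F B" using A by blast
  qed
next
  assume R: ?R
  show "continuous_map (column_topology G F) (column_topology G F) T"
    unfolding continuous_map_def topspace_column_topology[OF filter_F]
  proof (intro conjI T allI impI)
    fix W :: "('g \<Rightarrow> 'k) set" assume W: "openin (column_topology G F) W"
    show "openin (column_topology G F) {a \<in> column_space G F. T a \<in> W}"
      unfolding openin_column_topology
    proof (intro conjI ballI)
      fix a assume a: "a \<in> {a \<in> column_space G F. T a \<in> W}"
      then obtain B where B: "B \<in> perp G F"
        and BW: "fun_add_on G (T a) ` column_nbhd G F B \<subseteq> W"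
        using W unfolding openin_column_topology by blast
      obtain A where A: "A \<in> perp G F" and AB: "T ` column_nbhd G F A \<subseteq> column_nbhd G F B"
        using R B by blast
      have "fun_add_on G a u \<in> {a \<in> column_space G F. T a \<in> W}" if u: "u \<in> column_nbhd G F A" for u
      proof -
        have "u \<in> column_space G F" using u by (simp add: nbhd_iff)
        moreover have "fun_add_on G (T a) (T u) \<in> W" using AB BW u by blast
        ultimately show ?thesis using a by (simp add: add column_add)
      qed
      then show "\<exists>A\<in>perp G F. fun_add_on G a ` column_nbhd G F A \<subseteq> {a \<in> column_space G F. T a \<in> W}"
        using A by blast
    qed blast
  qed
qed

lemma endomorphism_iff:
  fixes T :: "('g \<Rightarrow> 'k::division_ring) \<Rightarrow> 'g \<Rightarrow> 'k"
  shows "T \<in> continuous_endomorphisms G F \<longleftrightarrow>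
    T \<in> column_space G F \<rightarrow>\<^sub>E column_space G F \<and>
    (\<forall>a\<in>column_space G F. \<forall>b\<in>column_space G F.
       T (fun_add_on G a b) = fun_add_on G (T a) (T b)) \<and>
    (\<forall>a\<in>column_space G F. \<forall>c. T (fun_scale_right_on G a c) = fun_scale_right_on G (T a) c) \<and>
    (\<forall>B\<in>perp G F. \<exists>A\<in>perp G F. T ` column_nbhd G F A \<subseteq> column_nbhd G F B)"
  using continuous_additive_iff[of T] by (auto simp: continuous_endomorphisms_def PiE_def)

lemma endomorphismI:
  fixes T :: "('g \<Rightarrow> 'k::division_ring) \<Rightarrow> 'g \<Rightarrow> 'k"
  assumes "T \<in> extensional (column_space G F)"
    and "\<And>a. a \<in> column_space G F \<Longrightarrow> T a \<in> column_space G F"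
    and "\<And>a b. a \<in> column_space G F \<Longrightarrow> b \<in> column_space G F \<Longrightarrow>
       T (fun_add_on G a b) = fun_add_on G (T a) (T b)"
    and "\<And>a c. a \<in> column_space G F \<Longrightarrow>
       T (fun_scale_right_on G a c) = fun_scale_right_on G (T a) c"
    and "\<And>B. B \<in> perp G F \<Longrightarrow> \<exists>A\<in>perp G F. \<forall>a\<in>column_nbhd G F A. T a \<in> column_nbhd G F B"
  shows "T \<in> continuous_endomorphisms G F"
  unfolding endomorphism_iff using assms by (auto simp: PiE_def image_subset_iff)

context
  fixes T :: "('g \<Rightarrow> 'k::division_ring) \<Rightarrow> 'g \<Rightarrow> 'k"
  assumes T: "T \<in> continuous_endomorphisms G F"
begin

lemma endomorphism_extensional: "T \<in> extensional (column_space G F)"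
  and endomorphism_closed: "a \<in> column_space G F \<Longrightarrow> T a \<in> column_space G F"
  and endomorphism_add: "a \<in> column_space G F \<Longrightarrow> b \<in> column_space G F \<Longrightarrow>
    T (fun_add_on G a b) = fun_add_on G (T a) (T b)"
  and endomorphism_scale: "a \<in> column_space G F \<Longrightarrow>
    T (fun_scale_right_on G a c) = fun_scale_right_on G (T a) c"
  using T by (auto simp: endomorphism_iff PiE_def)

lemma endomorphism_continuous:
  assumes "B \<in> perp G F"
  obtains A where "A \<in> perp G F" "\<And>a. a \<in> column_nbhd G F A \<Longrightarrow> T a \<in> column_nbhd G F B"
proof -
  obtain A where "A \<in> perp G F" "T ` column_nbhd G F A \<subseteq> column_nbhd G F B"
    using T assms unfolding endomorphism_iff by blast
  then show thesis using that by blast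
qed

lemma endomorphism_zero: "T (fun_zero_on G) = fun_zero_on G"
  using endomorphism_closed endomorphism_add by (intro additive_zero) auto

lemma endomorphism_finite_support:
  assumes "finite S" "S \<subseteq> G" "a \<in> column_space G F" "\<And>g. g \<in> G - S \<Longrightarrow> a g = 0" "h \<in> G"
  shows "T a h = (\<Sum>g\<in>S. T (unit_column G g) h * a g)"
  using assms(1-4)
proof (induction S arbitrary: a rule: finite_induct)
  case empty
  then have "a = fun_zero_on G"
    by (intro column_eqI column_zero) (auto simp: fun_zero_on_def)
  then show ?case using assms(5) by (simp add: endomorphism_zero) (simp add: fun_zero_on_def)
next
  case (insert x S)
  have x: "x \<in> G" using insert.prems by blast
  define b where "b = a(x := 0)"
  have b: "b \<in> column_space G F"
  proof -
    obtain A where "A \<in> F" "\<And>g. g \<in> A \<Longrightarrow> a g = 0"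
      using column_space_cases[OF insert.prems(2)] by blast
    then show ?thesis
      using column_space_extensional[OF insert.prems(2)] x
      by (intro column_spaceI[of b A]) (auto simp: b_def extensional_def)
  qed
  let ?u = "fun_scale_right_on G (unit_column G x) (a x)"
  have u: "?u \<in> column_space G F" by (intro column_scale column_unit)
  have "a = fun_add_on G b ?u"
    by (rule column_eqI[OF insert.prems(2) column_add[OF b u]])
      (auto simp: fun_add_on_def b_def fun_scale_right_on_def unit_column_def)
  then have "T a = fun_add_on G (T b) (fun_scale_right_on G (T (unit_column G x)) (a x))"
    by (metis endomorphism_add[OF b u] endomorphism_scale[OF column_unit])
  then have "T a h = T b h + T (unit_column G x) h * a x"
    using assms(5) by (simp add: fun_add_on_def fun_scale_right_on_def)
  also have "T b h = (\<Sum>g\<in>S. T (unit_column G g) h * b g)"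
    using insert.prems by (intro insert.IH b) (auto simp: b_def)
  also have "\<dots> = (\<Sum>g\<in>S. T (unit_column G g) h * a g)"
    using insert.hyps by (intro sum.cong) (auto simp: b_def)
  finally show ?case using insert.hyps by (simp add: add.commute)
qed

text \<open>A continuous endomorphism is determined by its values on the unit columns, although these need
  not span the column space: in each single position, all but a finite part of the column is
  invisible.\<close>

lemma endomorphism_expansion:
  assumes a: "a \<in> column_space G F" and h: "h \<in> G"
  shows "T a h = sum' (\<lambda>g. T (unit_column G g) h * a g) G"
proof -
  obtain C where C: "C \<in> perp G F"
    and TC: "\<And>b. b \<in> column_nbhd G F C \<Longrightarrow> T b \<in> column_nbhd G F (G - {h})"
    using endomorphism_continuous[of "G - {h}", OF remove_point_in_perp] by blast
  have vanish: "T b h = 0" if "b \<in> column_nbhd G F C" for b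
    using TC[OF that] h by (simp add: nbhd_iff)
  obtain A where A: "A \<in> F" and aA: "\<And>g. g \<in> A \<Longrightarrow> a g = 0"
    using column_space_cases[OF a] by blast
  \<comment> \<open>The entries of \<open>a\<close> on \<open>C\<close> do not affect position \<open>h\<close> of the image, and those on \<open>A\<close> are zero;
    what remains is finite.\<close>
  define S where "S = G - (C \<union> A)"
  have S: "finite S" "S \<subseteq> G" using perpD[OF C A] by (auto simp: S_def)
  define b where "b = (\<lambda>g\<in>G. if g \<in> S then a g else 0)"
  define u where "u = (\<lambda>g\<in>G. if g \<in> S then 0 else a g)"
  have b: "b \<in> column_space G F"
    using aA A filter_subset by (intro column_spaceI[of b A]) (auto simp: b_def)
  have u: "u \<in> column_space G F"
    using aA A filter_subset by (intro column_spaceI[of u A]) (auto simp: u_def)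
  have "u \<in> column_nbhd G F C"
    unfolding nbhd_iff using u aA by (auto simp: u_def S_def)
  moreover have "a = fun_add_on G b u"
    by (rule column_eqI[OF a column_add[OF b u]]) (auto simp: fun_add_on_def b_def u_def)
  ultimately have "T a h = T b h"
    using h vanish by (simp add: endomorphism_add[OF b u]) (simp add: fun_add_on_def)
  also have "\<dots> = (\<Sum>g\<in>S. T (unit_column G g) h * b g)"
    using S b h by (intro endomorphism_finite_support) (auto simp: b_def)
  also have "\<dots> = (\<Sum>g\<in>S. T (unit_column G g) h * a g)"
    using S by (intro sum.cong) (auto simp: b_def)
  also have "\<dots> = sum' (\<lambda>g. T (unit_column G g) h * a g) S"
    using S by (simp add: sum.eq_sum)
  also have "\<dots> = sum' (\<lambda>g. T (unit_column G g) h * a g) G"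
  proof (intro sum.mono_neutral_left' S ballI)
    fix g assume "g \<in> G - S"
    then consider "g \<in> C" | "g \<in> A" by (auto simp: S_def)
    then show "T (unit_column G g) h * a g = 0"
      by cases (simp_all add: vanish unit_column_nbhd aA)
  qed
  finally show ?thesis .
qed

end

lemma endomorphism_eqI:
  fixes T T' :: "('g \<Rightarrow> 'k::division_ring) \<Rightarrow> 'g \<Rightarrow> 'k"
  assumes "T \<in> continuous_endomorphisms G F" "T' \<in> continuous_endomorphisms G F"
    and "\<And>a h. a \<in> column_space G F \<Longrightarrow> h \<in> G \<Longrightarrow> T a h = T' a h"
  shows "T = T'"
proof (rule extensionalityI)
  show "T \<in> extensional (column_space G F)" "T' \<in> extensional (column_space G F)"
    using assms(1,2) by (simp_all add: endomorphism_extensional)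
  show "T a = T' a" if "a \<in> column_space G F" for a
    using assms that by (intro column_eqI) (auto simp: endomorphism_closed)
qed

lemma endomorphism_id:
  "(\<lambda>a\<in>column_space G F. a :: 'g \<Rightarrow> 'k::division_ring) \<in> continuous_endomorphisms G F"
proof (rule endomorphismI)
  fix B assume "B \<in> perp G F"
  then show "\<exists>A\<in>perp G F. \<forall>a\<in>column_nbhd G F A.
      (\<lambda>a\<in>column_space G F. a :: 'g \<Rightarrow> 'k) a \<in> column_nbhd G F B"
    by (intro bexI[of _ B]) (auto simp: nbhd_iff)
qed (auto simp: column_add column_scale)

lemma endomorphism_zero_map:
  "(\<lambda>a\<in>column_space G F. fun_zero_on G :: 'g \<Rightarrow> 'k::division_ring) \<in> continuous_endomorphisms G F"
proof (rule endomorphismI)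
  fix B assume "B \<in> perp G F"
  then show "\<exists>A\<in>perp G F. \<forall>a\<in>column_nbhd G F A.
      (\<lambda>a\<in>column_space G F. fun_zero_on G :: 'g \<Rightarrow> 'k) a \<in> column_nbhd G F B"
    by (intro bexI[of _ B]) (auto simp: nbhd_iff column_zero, auto simp: fun_zero_on_def)
qed (auto simp: column_add column_scale column_zero,
     auto simp: fun_zero_on_def fun_add_on_def fun_scale_right_on_def)

lemma endomorphism_plus:
  fixes T T' :: "('g \<Rightarrow> 'k::division_ring) \<Rightarrow> 'g \<Rightarrow> 'k"
  assumes T: "T \<in> continuous_endomorphisms G F" and T': "T' \<in> continuous_endomorphisms G F"
  shows "(\<lambda>a\<in>column_space G F. fun_add_on G (T a) (T' a)) \<in> continuous_endomorphisms G F"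
proof (rule endomorphismI)
  fix B assume B: "B \<in> perp G F"
  obtain A where A: "A \<in> perp G F" "\<And>a. a \<in> column_nbhd G F A \<Longrightarrow> T a \<in> column_nbhd G F B"
    using endomorphism_continuous[OF T B] by blast
  obtain A' where A': "A' \<in> perp G F" "\<And>a. a \<in> column_nbhd G F A' \<Longrightarrow> T' a \<in> column_nbhd G F B"
    using endomorphism_continuous[OF T' B] by blast
  have "A \<inter> A' \<in> perp G F"
    using is_filter_on_perp[of G F] A A' by (auto simp: is_filter_on_def)
  moreover have "fun_add_on G (T a) (T' a) \<in> column_nbhd G F B"
    if "a \<in> column_nbhd G F (A \<inter> A')" for a
  proof -
    have "a \<in> column_nbhd G F A" "a \<in> column_nbhd G F A'" using that by (auto simp: nbhd_iff)
    then have "T a \<in> column_nbhd G F B" "T' a \<in> column_nbhd G F B" using A A' by auto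
    then show ?thesis by (auto simp: nbhd_iff column_add) (simp add: fun_add_on_def)
  qed
  ultimately show "\<exists>A\<in>perp G F. \<forall>a\<in>column_nbhd G F A.
      (\<lambda>a\<in>column_space G F. fun_add_on G (T a) (T' a)) a \<in> column_nbhd G F B"
    by (intro bexI[of _ "A \<inter> A'"]) (auto simp: nbhd_iff)
qed (auto simp: column_add column_scale endomorphism_closed[OF T] endomorphism_closed[OF T']
       endomorphism_add[OF T] endomorphism_add[OF T'] endomorphism_scale[OF T]
       endomorphism_scale[OF T'],
     auto simp: fun_add_on_def fun_scale_right_on_def algebra_simps restrict_def)

text \<open>The negative is written as a right multiple, so that the closure lemmas for columns apply;
  it is linear because \<open>-1\<close> is central.\<close>

lemma endomorphism_uminus:
  fixes T :: "('g \<Rightarrow> 'k::division_ring) \<Rightarrow> 'g \<Rightarrow> 'k"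
  assumes T: "T \<in> continuous_endomorphisms G F"
  shows "(\<lambda>a\<in>column_space G F. fun_scale_right_on G (T a) (- 1)) \<in> continuous_endomorphisms G F"
proof (rule endomorphismI)
  fix B assume B: "B \<in> perp G F"
  obtain A where A: "A \<in> perp G F" "\<And>a. a \<in> column_nbhd G F A \<Longrightarrow> T a \<in> column_nbhd G F B"
    using endomorphism_continuous[OF T B] by blast
  have "fun_scale_right_on G (T a) (- 1) \<in> column_nbhd G F B" if "a \<in> column_nbhd G F A" for a
    using A(2)[OF that] by (auto simp: nbhd_iff column_scale) (simp add: fun_scale_right_on_def)
  then show "\<exists>A\<in>perp G F. \<forall>a\<in>column_nbhd G F A.
      (\<lambda>a\<in>column_space G F. fun_scale_right_on G (T a) (- 1)) a \<in> column_nbhd G F B"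
    using A(1) by (intro bexI[of _ A]) (auto simp: nbhd_iff)
qed (auto simp: column_add column_scale endomorphism_closed[OF T]
       endomorphism_add[OF T] endomorphism_scale[OF T],
     auto simp: fun_add_on_def fun_scale_right_on_def algebra_simps restrict_def)

lemma endomorphism_compose:
  fixes T T' :: "('g \<Rightarrow> 'k::division_ring) \<Rightarrow> 'g \<Rightarrow> 'k"
  assumes T: "T \<in> continuous_endomorphisms G F" and T': "T' \<in> continuous_endomorphisms G F"
  shows "compose (column_space G F) T T' \<in> continuous_endomorphisms G F"
proof (rule endomorphismI)
  fix B assume B: "B \<in> perp G F"
  obtain A where A: "A \<in> perp G F" "\<And>a. a \<in> column_nbhd G F A \<Longrightarrow> T a \<in> column_nbhd G F B"
    using endomorphism_continuous[OF T B] by blast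
  obtain C where C: "C \<in> perp G F" "\<And>a. a \<in> column_nbhd G F C \<Longrightarrow> T' a \<in> column_nbhd G F A"
    using endomorphism_continuous[OF T' A(1)] by blast
  show "\<exists>A\<in>perp G F. \<forall>a\<in>column_nbhd G F A.
      compose (column_space G F) T T' a \<in> column_nbhd G F B"
    using A C by (intro bexI[of _ C]) (auto simp: compose_def column_nbhd_def)
qed (auto simp: compose_def column_add column_scale endomorphism_closed[OF T]
       endomorphism_closed[OF T'] endomorphism_add[OF T] endomorphism_add[OF T']
       endomorphism_scale[OF T] endomorphism_scale[OF T'])

lemma ring_endomorphism_ring:
  "ring (endomorphism_ring G F :: (('g \<Rightarrow> 'k::division_ring) \<Rightarrow> 'g \<Rightarrow> 'k) ring)" (is "ring ?E")
proof (rule ringI)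
  note closure = endomorphism_plus endomorphism_zero_map endomorphism_uminus
    endomorphism_compose endomorphism_id
  note sel = endomorphism_ring_def
  show "abelian_group ?E"
  proof (rule abelian_groupI)
    fix T assume T: "T \<in> carrier ?E"
    show "\<exists>y\<in>carrier ?E. y \<oplus>\<^bsub>?E\<^esub> T = \<zero>\<^bsub>?E\<^esub>"
    proof (rule bexI)
      show "(\<lambda>a\<in>column_space G F. fun_scale_right_on G (T a) (- 1)) \<oplus>\<^bsub>?E\<^esub> T = \<zero>\<^bsub>?E\<^esub>"
        by (auto simp: sel fun_add_on_def fun_scale_right_on_def fun_zero_on_def
            restrict_def fun_eq_iff)
    qed (use T in \<open>simp add: sel closure\<close>)
  next
    fix T assume "T \<in> carrier ?E"
    then have T: "T \<in> continuous_endomorphisms G F" by (simp add: sel)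
    have "\<zero>\<^bsub>?E\<^esub> \<oplus>\<^bsub>?E\<^esub> T \<in> continuous_endomorphisms G F"
      using endomorphism_plus[OF endomorphism_zero_map T] by (simp add: sel)
    then show "\<zero>\<^bsub>?E\<^esub> \<oplus>\<^bsub>?E\<^esub> T = T"
      using T by (rule endomorphism_eqI) (simp add: sel fun_add_on_def fun_zero_on_def)
  qed (simp_all add: sel closure,
    auto simp: fun_add_on_def restrict_def fun_eq_iff add.assoc add.commute)
  show "monoid ?E"
  proof (rule monoidI)
    fix T assume "T \<in> carrier ?E"
    then have T: "T \<in> continuous_endomorphisms G F" by (simp add: sel)
    show "\<one>\<^bsub>?E\<^esub> \<otimes>\<^bsub>?E\<^esub> T = T" "T \<otimes>\<^bsub>?E\<^esub> \<one>\<^bsub>?E\<^esub> = T"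
      unfolding sel using T
      by (auto intro!: extensionalityI[of _ "column_space G F"]
          simp: compose_def endomorphism_extensional endomorphism_closed)
  qed (simp_all add: sel closure,
    auto simp: compose_def restrict_def fun_eq_iff endomorphism_closed)
qed (auto simp: endomorphism_ring_def compose_def restrict_def fun_eq_iff endomorphism_closed
    endomorphism_add)

end

section \<open>Matrices and continuous endomorphisms\<close>

locale balanced_filter_with_involution = balanced_filter G F
  for G :: "'g set" and F :: "'g set set" +
  fixes star :: "'g \<Rightarrow> 'g"
  assumes star: "involution_on G star"
begin

lemma star_closed [simp]: "g \<in> G \<Longrightarrow> star g \<in> G"
  and star_star [simp]: "g \<in> G \<Longrightarrow> star (star g) = g"
  using star by (auto simp: involution_on_def)

lemma star_image_complement:
  assumes "A \<subseteq> G"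
  shows "G - star ` A = star ` (G - A)"
proof -
  have "inj_on star G" by (rule inj_on_inverseI[of _ star]) simp
  moreover have "star ` G = G" using star_image_involution[OF star, of G] by force
  ultimately show ?thesis using inj_on_image_set_diff[of star G G A] assms by auto
qed

text \<open>In the form below the star is absorbed into the upper index of the matrix, where the product
  and the action on columns have it too, and both filters are \<open>F\<close> or its \<open>perp\<close>.\<close>

lemma filter_matrices_iff:
  fixes \<Phi> :: "'g \<times> 'g \<Rightarrow> 'k::division_ring"
  shows "\<Phi> \<in> filter_matrices G star F \<longleftrightarrow>
    \<Phi> \<in> extensional (G \<times> G) \<and>
    (\<forall>A\<in>F. \<exists>B\<in>F. \<forall>h\<in>B. \<forall>g\<in>G - A. \<Phi> (h, star g) = 0) \<and>
    (\<forall>B\<in>perp G F. \<exists>A\<in>perp G F. \<forall>h\<in>G - B. \<forall>g\<in>A. \<Phi> (h, star g) = 0)"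
proof -
  have "perp G (star_filter star (perp G F)) = star_filter star F"
    using perp_star_filter[OF star, of "perp G F"] perp_subset perp_perp by auto
  moreover have "B \<times> (G - star ` A) \<subseteq> zero_set (G \<times> G) \<Phi> \<longleftrightarrow>
      (\<forall>h\<in>B. \<forall>g\<in>G - A. \<Phi> (h, star g) = 0)" if "A \<in> F" "B \<in> F" for A B
  proof -
    have "A \<subseteq> G" "B \<subseteq> G" using that filter_subset by auto
    moreover from this have "G - star ` A = star ` (G - A)"
      using star_image_complement by blast
    ultimately show ?thesis by (auto simp: zero_set_def subset_iff)
  qed
  moreover have "(G - B) \<times> star ` A \<subseteq> zero_set (G \<times> G) \<Phi> \<longleftrightarrow>
      (\<forall>h\<in>G - B. \<forall>g\<in>A. \<Phi> (h, star g) = 0)" if "A \<in> perp G F" for A B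
    using perp_subset[OF that] by (auto simp: zero_set_def subset_iff)
  ultimately show ?thesis
    by (simp add: filter_matrices_def angle_filter_def star_filter_def PiE_def)
       (auto simp: zero_set_def)
qed

context
  fixes \<Phi> :: "'g \<times> 'g \<Rightarrow> 'k::division_ring"
  assumes \<Phi>: "\<Phi> \<in> filter_matrices G star F"
begin

lemma matrix_zero_columns:
  "A \<in> F \<Longrightarrow> \<exists>B\<in>F. \<forall>h\<in>B. \<forall>g\<in>G - A. \<Phi> (h, star g) = 0"
  using \<Phi> unfolding filter_matrices_iff by blast

lemma matrix_zero_rows:
  "B \<in> perp G F \<Longrightarrow> \<exists>A\<in>perp G F. \<forall>h\<in>G - B. \<forall>g\<in>A. \<Phi> (h, star g) = 0"
  using \<Phi> unfolding filter_matrices_iff by blast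

text \<open>Columns of matrices are columns in the sense of the column space, so facts about \<open>matrix_vec\<close>
  carry over to products of matrices.\<close>

lemma matrix_column:
  assumes "g \<in> G"
  shows "(\<lambda>h\<in>G. \<Phi> (h, g)) \<in> column_space G F"
proof -
  obtain B where B: "B \<in> F" "\<forall>h\<in>B. \<forall>g'\<in>G - (G - {star g}). \<Phi> (h, star g') = 0"
    using matrix_zero_columns[OF remove_point_in_filter] by blast
  have "\<forall>h\<in>B. \<Phi> (h, star (star g)) = 0" using B(2) star_closed[OF assms] by blast
  then show ?thesis
    by (intro column_spaceI[OF _ B(1)]) (use filter_subset[OF B(1)] assms in auto)
qed

text \<open>A row vanishes on a set in \<open>perp G F\<close> and a column vanishes on a set in \<open>F\<close>, so at most
  finitely many positions escape both.\<close>

lemma matrix_vec_finite: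
  assumes a: "a \<in> column_space G F" and h: "h \<in> G"
  shows "finite {g \<in> G. \<Phi> (h, star g) * a g \<noteq> 0}"
proof -
  obtain C where C: "C \<in> perp G F" "\<forall>h'\<in>G - (G - {h}). \<forall>g\<in>C. \<Phi> (h', star g) = 0"
    using matrix_zero_rows[OF remove_point_in_perp] by blast
  obtain A where A: "A \<in> F" "\<And>g. g \<in> A \<Longrightarrow> a g = 0"
    using column_space_cases[OF a] by blast
  have "{g \<in> G. \<Phi> (h, star g) * a g \<noteq> 0} \<subseteq> G - (C \<union> A)"
    using A(2) C(2) h by auto
  then show ?thesis using perpD[OF C(1) A(1)] by (rule finite_subset)
qed

lemma matrix_vec_add:
  assumes "a \<in> column_space G F" "b \<in> column_space G F"
  shows "matrix_vec G star \<Phi> (fun_add_on G a b) =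
    fun_add_on G (matrix_vec G star \<Phi> a) (matrix_vec G star \<Phi> b)"
proof (rule extensionalityI)
  fix h assume h: "h \<in> G"
  have "sum' (\<lambda>g. \<Phi> (h, star g) * fun_add_on G a b g) G =
      sum' (\<lambda>g. \<Phi> (h, star g) * a g + \<Phi> (h, star g) * b g) G"
    by (rule sum.cong') (auto simp: fun_add_on_def distrib_left)
  also have "\<dots> = sum' (\<lambda>g. \<Phi> (h, star g) * a g) G + sum' (\<lambda>g. \<Phi> (h, star g) * b g) G"
    by (intro sum.distrib' matrix_vec_finite assms h)
  finally show "matrix_vec G star \<Phi> (fun_add_on G a b) h =
      fun_add_on G (matrix_vec G star \<Phi> a) (matrix_vec G star \<Phi> b) h"
    using h by (simp add: matrix_vec_def) (simp add: fun_add_on_def)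
qed (auto simp: matrix_vec_def fun_add_on_def)

lemma matrix_vec_scale:
  assumes a: "a \<in> column_space G F"
  shows "matrix_vec G star \<Phi> (fun_scale_right_on G a c) =
    fun_scale_right_on G (matrix_vec G star \<Phi> a) c"
proof (rule extensionalityI)
  fix h assume h: "h \<in> G"
  let ?S = "{g \<in> G. \<Phi> (h, star g) * a g \<noteq> 0}"
  note fin = matrix_vec_finite[OF a h]
  have "sum' (\<lambda>g. \<Phi> (h, star g) * fun_scale_right_on G a c g) G =
      sum' (\<lambda>g. \<Phi> (h, star g) * a g * c) ?S"
    by (rule sum.mono_neutral_cong_right') (auto simp: fun_scale_right_on_def mult.assoc)
  also have "\<dots> = (\<Sum>g\<in>?S. \<Phi> (h, star g) * a g) * c"
    using fin by (simp add: sum.eq_sum sum_distrib_right)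
  also have "(\<Sum>g\<in>?S. \<Phi> (h, star g) * a g) = sum' (\<lambda>g. \<Phi> (h, star g) * a g) G"
    using fin by (simp add: sum.G_def)
  finally show "matrix_vec G star \<Phi> (fun_scale_right_on G a c) h =
      fun_scale_right_on G (matrix_vec G star \<Phi> a) c h"
    using h by (simp add: matrix_vec_def) (simp add: fun_scale_right_on_def)
qed (auto simp: matrix_vec_def fun_scale_right_on_def)

lemma matrix_vec_closed:
  assumes a: "a \<in> column_space G F"
  shows "matrix_vec G star \<Phi> a \<in> column_space G F"
proof -
  obtain A where A: "A \<in> F" "\<And>g. g \<in> A \<Longrightarrow> a g = 0"
    using column_space_cases[OF a] by blast
  obtain B where B: "B \<in> F" "\<forall>h\<in>B. \<forall>g\<in>G - A. \<Phi> (h, star g) = 0"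
    using matrix_zero_columns[OF A(1)] by blast
  show ?thesis
  proof (rule column_spaceI[OF _ B(1)])
    fix h assume h: "h \<in> B"
    have "sum' (\<lambda>g. \<Phi> (h, star g) * a g) G = sum' (\<lambda>g. \<Phi> (h, star g) * a g) {}"
      by (rule sum.mono_neutral_right') (use A(2) B(2) h in auto)
    then show "matrix_vec G star \<Phi> a h = 0"
      using h filter_subset[OF B(1)] by (auto simp: matrix_vec_def)
  qed (simp add: matrix_vec_def)
qed

lemma matrix_vec_continuous:
  assumes "B \<in> perp G F"
  shows "\<exists>A\<in>perp G F. \<forall>a\<in>column_nbhd G F A. matrix_vec G star \<Phi> a \<in> column_nbhd G F B"
proof -
  obtain A where A: "A \<in> perp G F" "\<forall>h\<in>G - B. \<forall>g\<in>A. \<Phi> (h, star g) = 0"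
    using matrix_zero_rows[OF assms] by blast
  have "matrix_vec G star \<Phi> a h = 0" if a: "a \<in> column_nbhd G F A" and h: "h \<in> G - B" for a h
  proof -
    have "sum' (\<lambda>g. \<Phi> (h, star g) * a g) G = sum' (\<lambda>g. \<Phi> (h, star g) * a g) {}"
      by (rule sum.mono_neutral_right') (use A(2) h a in \<open>auto simp: nbhd_iff\<close>)
    then show ?thesis using h by (simp add: matrix_vec_def)
  qed
  then have "\<forall>a\<in>column_nbhd G F A. matrix_vec G star \<Phi> a \<in> column_nbhd G F B"
    by (simp add: nbhd_iff matrix_vec_closed)
  then show ?thesis using A(1) by blast
qed

lemma hat_endomorphism: "hat G star F \<Phi> \<in> continuous_endomorphisms G F"
proof (rule endomorphismI)
  fix B assume "B \<in> perp G F"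
  then show "\<exists>A\<in>perp G F. \<forall>a\<in>column_nbhd G F A. hat G star F \<Phi> a \<in> column_nbhd G F B"
    using matrix_vec_continuous[of B] by (auto simp: hat_def nbhd_iff)
qed (auto simp: hat_def matrix_vec_closed matrix_vec_add matrix_vec_scale column_add column_scale)

lemma hat_unit_column:
  assumes h: "h \<in> G" and g: "g \<in> G"
  shows "hat G star F \<Phi> (unit_column G g) h = \<Phi> (h, star g)"
proof -
  have "sum' (\<lambda>g'. \<Phi> (h, star g') * unit_column G g g') G =
      sum' (\<lambda>g'. \<Phi> (h, star g') * unit_column G g g') {g}"
    by (rule sum.mono_neutral_right') (use g in \<open>auto simp: unit_column_def\<close>)
  also have "\<dots> = \<Phi> (h, star g)"
    using g by (simp add: sum.eq_sum) (simp add: unit_column_def)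
  finally show ?thesis using h by (simp add: hat_def column_unit matrix_vec_def)
qed

end

lemma matrix_mult_is_defined:
  fixes \<Phi> \<Psi> :: "'g \<times> 'g \<Rightarrow> 'k::division_ring"
  assumes "\<Phi> \<in> filter_matrices G star F" "\<Psi> \<in> filter_matrices G star F"
  shows "matrix_mult_defined G star \<Phi> \<Psi>"
  unfolding matrix_mult_defined_def
proof (intro ballI)
  fix j g assume "j \<in> G" "g \<in> G"
  then have "finite {h \<in> G. \<Phi> (j, star h) * (\<lambda>h\<in>G. \<Psi> (h, g)) h \<noteq> 0}"
    by (intro matrix_vec_finite matrix_column assms)
  then show "finite {h \<in> G. \<Phi> (j, star h) * \<Psi> (h, g) \<noteq> 0}"
    by (rule finite_subset[rotated]) auto
qed

text \<open>The matrix of an endomorphism with respect to the unit columns.  The upper index is starred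
  because the action of a matrix on columns pairs the upper index \<open>star g\<close> with the position \<open>g\<close>.\<close>

definition endo_matrix :: "(('g \<Rightarrow> 'k::division_ring) \<Rightarrow> 'g \<Rightarrow> 'k) \<Rightarrow> 'g \<times> 'g \<Rightarrow> 'k" where
  "endo_matrix T = (\<lambda>(h, g)\<in>G \<times> G. T (unit_column G (star g)) h)"

lemma endo_matrix_apply [simp]:
  "h \<in> G \<Longrightarrow> g \<in> G \<Longrightarrow> endo_matrix T (h, g) = T (unit_column G (star g)) h"
  by (simp add: endo_matrix_def)

text \<open>The condition on the rows outside a set in \<open>perp G F\<close> is continuity, read off on the unit
  columns.  The condition on the columns outside a set \<open>A \<in> F\<close> follows from it.  Let \<open>B\<close> be the set
  of all rows vanishing outside \<open>A\<close>, and let \<open>D \<in> perp G F\<close>.  The rows outside \<open>D\<close> vanish on some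
  \<open>C \<in> perp G F\<close>, so a row outside \<open>B \<union> D\<close> has a nonzero entry in one of the finitely many columns
  outside \<open>A \<union> C\<close>; and each of these columns has only finitely many nonzero entries outside \<open>D\<close>.
  Hence \<open>B \<union> D\<close> is cofinite, and \<open>B \<in> F\<close> because \<open>F\<close> is balanced.\<close>

lemma endo_matrix_closed:
  fixes T :: "('g \<Rightarrow> 'k::division_ring) \<Rightarrow> 'g \<Rightarrow> 'k"
  assumes T: "T \<in> continuous_endomorphisms G F"
  shows "endo_matrix T \<in> filter_matrices G star F"
  unfolding filter_matrices_iff
proof (intro conjI ballI)
  have rows: "\<exists>A\<in>perp G F. \<forall>h\<in>G - B. \<forall>g\<in>A. T (unit_column G g) h = 0"
    if "B \<in> perp G F" for B
  proof -
    obtain A where "A \<in> perp G F" "\<And>a. a \<in> column_nbhd G F A \<Longrightarrow> T a \<in> column_nbhd G F B"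
      using endomorphism_continuous[OF T \<open>B \<in> perp G F\<close>] by blast
    then show ?thesis using unit_column_nbhd by (meson nbhd_iff)
  qed
  show "\<exists>A\<in>perp G F. \<forall>h\<in>G - B. \<forall>g\<in>A. endo_matrix T (h, star g) = 0"
    if B: "B \<in> perp G F" for B
  proof -
    obtain A where A: "A \<in> perp G F" "\<forall>h\<in>G - B. \<forall>g\<in>A. T (unit_column G g) h = 0"
      using rows[OF B] by blast
    then show ?thesis using perp_subset[OF A(1)] by (intro bexI[of _ A]) (auto simp: subset_iff)
  qed
  fix A assume A: "A \<in> F"
  define B where "B = {h \<in> G. \<forall>g\<in>G - A. T (unit_column G g) h = 0}"
  have "B \<in> F"
  proof (rule filterI)
    fix D assume D: "D \<in> perp G F"
    obtain C where C: "C \<in> perp G F" "\<forall>h\<in>G - D. \<forall>g\<in>C. T (unit_column G g) h = 0"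
      using rows[OF D] by blast
    have "G - (B \<union> D) \<subseteq>
        (\<Union>g\<in>G - (C \<union> A). G - (D \<union> zero_set G (T (unit_column G g))))"
      using C(2) by (fastforce simp: B_def zero_set_def)
    moreover have "finite (G - (D \<union> zero_set G (T (unit_column G g))))" for g
      using endomorphism_closed[OF T column_unit[of g]]
      by (intro perpD[OF D]) (simp add: column_space_def)
    ultimately show "finite (G - (B \<union> D))"
      using perpD[OF C(1) A] by (meson finite_UN_I finite_subset)
  qed (auto simp: B_def)
  then show "\<exists>B\<in>F. \<forall>h\<in>B. \<forall>g\<in>G - A. endo_matrix T (h, star g) = 0"
    by (intro bexI[of _ B]) (auto simp: B_def)
qed (auto simp: endo_matrix_def)

lemma hat_endo_matrix:
  fixes T :: "('g \<Rightarrow> 'k::division_ring) \<Rightarrow> 'g \<Rightarrow> 'k"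
  assumes T: "T \<in> continuous_endomorphisms G F"
  shows "hat G star F (endo_matrix T) = T"
proof (rule endomorphism_eqI)
  show "hat G star F (endo_matrix T) \<in> continuous_endomorphisms G F"
    by (intro hat_endomorphism endo_matrix_closed T)
  fix a :: "'g \<Rightarrow> 'k" and h assume a: "a \<in> column_space G F" and h: "h \<in> G"
  have "sum' (\<lambda>g. endo_matrix T (h, star g) * a g) G = sum' (\<lambda>g. T (unit_column G g) h * a g) G"
    by (rule sum.cong') (auto simp: h)
  then show "hat G star F (endo_matrix T) a h = T a h"
    using a h by (simp add: hat_def matrix_vec_def endomorphism_expansion[OF T a h])
qed (rule T)

lemma endo_matrix_hat:
  fixes \<Phi> :: "'g \<times> 'g \<Rightarrow> 'k::division_ring"
  assumes \<Phi>: "\<Phi> \<in> filter_matrices G star F"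
  shows "endo_matrix (hat G star F \<Phi>) = \<Phi>"
proof (rule extensionalityI)
  show "\<Phi> \<in> extensional (G \<times> G)" using \<Phi> by (simp add: filter_matrices_iff)
qed (auto simp: endo_matrix_def hat_unit_column[OF \<Phi>])

text \<open>The product formula is the expansion of \<open>T\<close>, evaluated at the columns \<open>T' e\<^sub>g\<close>.\<close>

lemma endo_matrix_ring_iso:
  "endo_matrix \<in> ring_iso
     (endomorphism_ring G F :: (('g \<Rightarrow> 'k::division_ring) \<Rightarrow> 'g \<Rightarrow> 'k) ring)
     (matrix_ring G star F)"
    (is "_ \<in> ring_iso ?E ?M")
proof (rule ring_iso_memI)
  have carriers: "carrier ?E = continuous_endomorphisms G F" "carrier ?M = filter_matrices G star F"
    by (simp_all add: endomorphism_ring_def matrix_ring_def)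
  show "bij_betw endo_matrix (carrier ?E) (carrier ?M)"
    unfolding carriers
    by (rule bij_betw_byWitness[where f' = "hat G star F"])
      (auto simp: hat_endo_matrix endo_matrix_hat endo_matrix_closed hat_endomorphism)
  show "endo_matrix T \<in> carrier ?M" if "T \<in> carrier ?E" for T
    using that unfolding carriers by (rule endo_matrix_closed)
  show "endo_matrix (T \<oplus>\<^bsub>?E\<^esub> T') = endo_matrix T \<oplus>\<^bsub>?M\<^esub> endo_matrix T'" for T T'
    by (rule extensionalityI[of _ "G \<times> G"])
      (auto simp: endomorphism_ring_def matrix_ring_def endo_matrix_def fun_add_on_def column_unit)
  show "endo_matrix \<one>\<^bsub>?E\<^esub> = \<one>\<^bsub>?M\<^esub>"
    by (rule extensionalityI[of _ "G \<times> G"])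
      (auto simp: endomorphism_ring_def matrix_ring_def endo_matrix_def column_unit,
       auto simp: unit_column_def)
  fix T T' assume "T \<in> carrier ?E" "T' \<in> carrier ?E"
  then have T: "T \<in> continuous_endomorphisms G F" and T': "T' \<in> continuous_endomorphisms G F"
    by (simp_all add: carriers)
  show "endo_matrix (T \<otimes>\<^bsub>?E\<^esub> T') = endo_matrix T \<otimes>\<^bsub>?M\<^esub> endo_matrix T'"
  proof (rule extensionalityI[of _ "G \<times> G"])
    fix p assume "p \<in> G \<times> G"
    then obtain j g where p: "p = (j, g)" and j: "j \<in> G" and g: "g \<in> G" by blast
    let ?e = "unit_column G (star g)"
    have "endo_matrix (T \<otimes>\<^bsub>?E\<^esub> T') p = T (T' ?e) j"
      using j g by (simp add: p endomorphism_ring_def compose_def column_unit)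
    also have "\<dots> = sum' (\<lambda>h. T (unit_column G h) j * T' ?e h) G"
      by (rule endomorphism_expansion[OF T endomorphism_closed[OF T' column_unit] j])
    also have "\<dots> = sum' (\<lambda>h. endo_matrix T (j, star h) * endo_matrix T' (h, g)) G"
      by (rule sum.cong') (auto simp: j g)
    also have "\<dots> = (endo_matrix T \<otimes>\<^bsub>?M\<^esub> endo_matrix T') p"
      using j g by (simp add: p matrix_ring_def matrix_mult_def)
    finally show "endo_matrix (T \<otimes>\<^bsub>?E\<^esub> T') p = (endo_matrix T \<otimes>\<^bsub>?M\<^esub> endo_matrix T') p" .
  qed (auto simp: endo_matrix_def matrix_ring_def matrix_mult_def)
qed

text \<open>Transport of structure along a ring isomorphism in the sense of the library yields a ring
  whose zero is the image of zero; it has to be identified with the zero matrix.\<close>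

lemma ring_matrix_ring:
  "ring (matrix_ring G star F :: ('g \<times> 'g \<Rightarrow> 'k::division_ring) ring)" (is "ring ?M")
proof -
  let ?E = "endomorphism_ring G F :: (('g \<Rightarrow> 'k) \<Rightarrow> 'g \<Rightarrow> 'k) ring"
  have "endo_matrix \<zero>\<^bsub>?E\<^esub> = \<zero>\<^bsub>?M\<^esub>"
    by (rule extensionalityI[of _ "G \<times> G"])
      (auto simp: endomorphism_ring_def matrix_ring_def endo_matrix_def column_unit fun_zero_on_def)
  then have "?M\<lparr>zero := endo_matrix \<zero>\<^bsub>?E\<^esub>\<rparr> = ?M" by simp
  then show ?thesis
    using ring.ring_iso_imp_img_ring[OF ring_endomorphism_ring endo_matrix_ring_iso] by metis
qed

lemma hat_ring_iso:
  "(hat G star F :: ('g \<times> 'g \<Rightarrow> 'k::division_ring) \<Rightarrow> _)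
     \<in> ring_iso (matrix_ring G star F) (endomorphism_ring G F)" (is "_ \<in> ring_iso ?M ?E")
proof (rule ring.ring_iso_restrict)
  show "inv_into (carrier ?E) endo_matrix \<in> ring_iso ?M ?E"
    by (rule ring_iso_set_sym[OF ring_endomorphism_ring endo_matrix_ring_iso])
  fix \<Phi> assume "\<Phi> \<in> carrier ?M"
  then have \<Phi>: "\<Phi> \<in> filter_matrices G star F" by (simp add: matrix_ring_def)
  have "inj_on endo_matrix (carrier ?E)"
    using ring_iso_memE(5)[OF endo_matrix_ring_iso] by (rule bij_betw_imp_inj_on)
  moreover have "hat G star F \<Phi> \<in> carrier ?E"
    using hat_endomorphism[OF \<Phi>] by (simp add: endomorphism_ring_def)
  ultimately show "inv_into (carrier ?E) endo_matrix \<Phi> = hat G star F \<Phi>"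
    using endo_matrix_hat[OF \<Phi>] by (metis inv_into_f_eq)
qed (rule ring_matrix_ring)

end

theorem theorem10p7:
  fixes G :: "'g set" and star :: "'g \<Rightarrow> 'g" and F :: "'g set set"
  assumes "involution_on G star"
    and "is_filter_on G F"
    and "balanced G F"
  shows
    "((\<forall>\<Phi> \<in> (filter_matrices G star F :: ('g \<times> 'g \<Rightarrow> 'k::division_ring) set).
        \<forall>\<Psi> \<in> filter_matrices G star F. matrix_mult_defined G star \<Phi> \<Psi>) \<and>
      ring (matrix_ring G star F :: ('g \<times> 'g \<Rightarrow> 'k) ring)) \<and>
     (\<forall>\<Phi> \<in> (filter_matrices G star F :: ('g \<times> 'g \<Rightarrow> 'k) set).
        (\<forall>a \<in> column_space G F. matrix_vec_defined G star \<Phi> a) \<and>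
        hat G star F \<Phi> \<in> continuous_endomorphisms G F) \<and>
     (ring (endomorphism_ring G F :: (('g \<Rightarrow> 'k) \<Rightarrow> 'g \<Rightarrow> 'k) ring) \<and>
      (hat G star F :: ('g \<times> 'g \<Rightarrow> 'k) \<Rightarrow> ('g \<Rightarrow> 'k) \<Rightarrow> 'g \<Rightarrow> 'k)
        \<in> ring_iso (matrix_ring G star F) (endomorphism_ring G F))"
proof -
  interpret balanced_filter_with_involution G F star
    using assms by unfold_locales
  show ?thesis
    using matrix_mult_is_defined ring_matrix_ring hat_endomorphism ring_endomorphism_ring
      hat_ring_iso matrix_vec_finite
    unfolding matrix_vec_defined_def by (intro conjI ballI) assumption+
qed

end
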